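(* Let $n\ge 1$, $k\ge 0$ and $\ell\ge 1$ be integers with $\ell\le k+1$. Consider families $\mathcal{F}\subset 2^{[n]}$ such that there are no two sets $A,B\in\mathcal{F}$ satisfying $A\subset B$ and $|B\setminus A|>k$. Among such families, the ones containing the most $\ell$-chains are $$\left\{F\subset[n] : \left\lfloor\tfrac{n-k}{2}\right\rfloor\le|F|\le\left\lfloor\tfrac{n+k}{2}\right\rfloor\right\}\quad\text{and}\quad\left\{F\subset[n] : \left\lceil\tfrac{n-k}{2}\right\rceil\le|F|\le\left\lceil\tfrac{n+k}{2}\right\rceil\right\}.$$ (These two families are the same if $n+k$ is even.)
   Context: $[n]=\{1,2,\dots,n\}$ and $2^{[n]}$ is the family of all subsets of $[n]$. An $\ell$-chain is a family $\{G_1,\dots,G_\ell\}$ of $\ell$ distinct subsets of $[n]$ with $G_1\subset G_2\subset\dots\subset G_\ell$; a family $\mathcal{F}$ contains the $\ell$-chain if $\{G_1,\dots,G_\ell\}\subset\mathcal{F}$.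
   Formalization: That no other families contain the most ℓ-chains is asserted only for ℓ ≤ n+1; for ℓ ≥ n+2 there are no ℓ-chains in 2^[n], so every family ties with 0 and that claim is false (e.g. n=1, k=2, ℓ=3, empty family). *)

theory Defs
  imports Complex_Main
begin

definition gap_bounded :: "nat \<Rightarrow> nat \<Rightarrow> nat set set \<Rightarrow> bool" where
  "gap_bounded n k F \<longleftrightarrow>
     F \<subseteq> Pow {1..n} \<and> \<not> (\<exists>A\<in>F. \<exists>B\<in>F. A \<subset> B \<and> card (B - A) > k)"

text \<open>Strict inclusion already makes the members of \<open>Gs\<close> distinct. A chain is the unordered
  family \<open>set Gs\<close>, so each chain is counted once.\<close>

definition is_chain :: "nat \<Rightarrow> nat \<Rightarrow> nat set set \<Rightarrow> bool" where
  "is_chain n l C \<longleftrightarrow>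
     (\<exists>Gs. length Gs = l \<and> sorted_wrt (\<subset>) Gs \<and> set Gs \<subseteq> Pow {1..n} \<and> C = set Gs)"

definition num_chains :: "nat \<Rightarrow> nat \<Rightarrow> nat set set \<Rightarrow> nat" where
  "num_chains n l F = card {C. is_chain n l C \<and> C \<subseteq> F}"

text \<open>The bounds below are integers, and the lower ones are negative when \<open>k\<close> is large compared
  with \<open>n\<close>.\<close>

definition lower_family :: "nat \<Rightarrow> nat \<Rightarrow> nat set set" where
  "lower_family n k = {F. F \<subseteq> {1..n} \<and>
     \<lfloor>(real n - real k) / 2\<rfloor> \<le> int (card F) \<and> int (card F) \<le> \<lfloor>(real n + real k) / 2\<rfloor>}"

definition upper_family :: "nat \<Rightarrow> nat \<Rightarrow> nat set set" where
  "upper_family n k = {F. F \<subseteq> {1..n} \<and>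
     \<lceil>(real n - real k) / 2\<rceil> \<le> int (card F) \<and> int (card F) \<le> \<lceil>(real n + real k) / 2\<rceil>}"

end

theory Submission
  imports Defs "HOL-Combinatorics.Permutations"
begin

text \<open>Fix the sizes of the members of an \<open>l\<close>-chain. Every chain with these sizes lies in equally
  many maximal chains of \<open>2^[n]\<close>, so the number of \<open>l\<close>-chains in \<open>F\<close> is the average, over the
  maximal chains \<open>p\<close>, of a positive weight summed over the \<open>l\<close>-subsets of the set of levels where
  \<open>p\<close> meets \<open>F\<close>. That set lies in a window \<open>{i..i + k}\<close>. Consecutive windows are compared
  by reflecting the size profiles containing the level \<open>i\<close> to those containing \<open>i + k + 1\<close>, which
  changes only two factorials in the multinomial coefficient; hence the central windows are the
  heaviest. If \<open>F\<close> is extremal, each maximal chain meets it in exactly a central window. If there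
  are two such windows, sets of the lowest level that differ by one exchange have a common superset
  in the highest level, so all maximal chains use the same window.\<close>

section \<open>Chains with prescribed sizes\<close>

definition profile_chains :: "nat \<Rightarrow> nat list \<Rightarrow> nat set list set" where
  "profile_chains n xs =
     {Gs. sorted_wrt (\<subset>) Gs \<and> set Gs \<subseteq> Pow {1..n} \<and> map card Gs = xs}"

text \<open>The inner factors of a multinomial denominator. The outer ones,
  \<open>fact (hd xs)\<close> and \<open>fact (n - last xs)\<close>, are kept apart because
  reflection alters only those.\<close>

fun gap_fact :: "nat list \<Rightarrow> nat" where
  "gap_fact (a # b # xs) = fact (b - a) * gap_fact (b # xs)"
| "gap_fact _ = 1"

lemma gap_fact_pos: "gap_fact xs > 0"
  by (induction xs rule: gap_fact.induct) auto

lemma gap_fact_snoc: "xs \<noteq> [] \<Longrightarrow> gap_fact (xs @ [y]) = gap_fact xs * fact (y - last xs)"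
  by (induction xs rule: gap_fact.induct) auto

text \<open>Reflection only reverses the order of the consecutive differences; the bound by
  \<open>c\<close> keeps truncated subtraction exact.\<close>

lemma gap_fact_reflect:
  assumes "sorted_wrt (<) xs" "\<forall>x\<in>set xs. x \<le> c"
  shows "gap_fact (rev (map (\<lambda>x. c - x) xs)) = gap_fact xs"
  using assms
proof (induction xs rule: gap_fact.induct)
  case (1 a b xs)
  have "(c - a) - (c - b) = b - a"
    using 1 by auto
  then show ?case
    using 1 gap_fact_snoc[of "rev (map (\<lambda>x. c - x) (b # xs))" "c - a"]
    by (simp add: last_rev)
qed auto

lemma finite_profile_chains: "finite (profile_chains n xs)"
proof (rule finite_subset)
  show "profile_chains n xs \<subseteq> {Gs. set Gs \<subseteq> Pow {1..n} \<and> length Gs = length xs}"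
    by (auto simp: profile_chains_def)
qed (simp add: finite_lists_length_eq)

text \<open>A multinomial coefficient, written as a product to avoid division. Induction strips the
  smallest member, which is an arbitrary \<open>a\<close>-subset of the next one and so contributes
  \<open>b choose a\<close>.\<close>

lemma card_profile_chains:
  assumes "sorted_wrt (<) xs" "xs \<noteq> []" "set xs \<subseteq> {..n}"
  shows "card (profile_chains n xs) * (fact (hd xs) * gap_fact xs * fact (n - last xs)) = fact n"
  using assms
proof (induction xs rule: gap_fact.induct)
  case (1 a b xs)
  let ?P = "profile_chains n (b # xs)"
  let ?S = "Sigma ?P (\<lambda>Gs. {A. A \<subseteq> hd Gs \<and> card A = a})"
  have ab: "a < b" "\<forall>x\<in>set xs. b < x"
    using 1 by auto
  have hd: "finite (hd Gs)" "card (hd Gs) = b" "hd Gs \<in> set Gs" "\<forall>G\<in>set Gs. hd Gs \<subseteq> G"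
    if Gs: "Gs \<in> ?P" for Gs
  proof -
    obtain G Gs' where "Gs = G # Gs'"
      using Gs by (cases Gs) (auto simp: profile_chains_def)
    then show "finite (hd Gs)" "card (hd Gs) = b" "hd Gs \<in> set Gs" "\<forall>G\<in>set Gs. hd Gs \<subseteq> G"
      using Gs by (auto simp: profile_chains_def intro: finite_subset[of _ "{Suc 0..n}"])
  qed
  have "profile_chains n (a # b # xs) = (\<lambda>(Gs, A). A # Gs) ` ?S"
  proof (intro equalityI subsetI)
    fix Hs assume "Hs \<in> profile_chains n (a # b # xs)"
    then obtain A B Gs where Hs: "Hs = A # B # Gs" "A # B # Gs \<in> profile_chains n (a # b # xs)"
      by (auto simp: profile_chains_def Cons_eq_map_conv map_eq_Cons_conv)
    then have "(B # Gs, A) \<in> ?S"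
      by (auto simp: profile_chains_def)
    then show "Hs \<in> (\<lambda>(Gs, A). A # Gs) ` ?S"
      using Hs(1) by force
  next
    fix Hs assume "Hs \<in> (\<lambda>(Gs, A). A # Gs) ` ?S"
    then obtain Gs A where Hs: "Hs = A # Gs" "Gs \<in> ?P" "A \<subseteq> hd Gs" "card A = a"
      by auto
    have "A \<subset> hd Gs"
      using Hs hd(2)[OF Hs(2)] ab by auto
    then have "\<forall>G\<in>set Gs. A \<subset> G"
      using hd(4)[OF Hs(2)] by auto
    moreover have "A \<subseteq> {1..n}"
      using hd(3)[OF Hs(2)] Hs by (auto simp: profile_chains_def)
    ultimately show "Hs \<in> profile_chains n (a # b # xs)"
      using Hs by (auto simp: profile_chains_def)
  qed
  moreover have "inj_on (\<lambda>(Gs, A). A # Gs) ?S"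
    by (auto simp: inj_on_def)
  ultimately have "card (profile_chains n (a # b # xs)) = card ?S"
    by (simp add: card_image)
  also have "\<dots> = (\<Sum>Gs\<in>?P. b choose a)"
    using hd by (subst card_SigmaI) (auto simp: finite_profile_chains n_subsets)
  also have "\<dots> = card ?P * (b choose a)"
    by simp
  finally have card: "card (profile_chains n (a # b # xs)) = card ?P * (b choose a)" .
  have "card ?P * (fact b * gap_fact (b # xs) * fact (n - last (b # xs))) = fact n"
    using 1 by simp
  moreover have "fact a * fact (b - a) * (b choose a) = (fact b :: nat)"
    using ab by (intro binomial_fact_lemma) simp
  ultimately show ?case
    unfolding card by (simp flip: \<open>fact a * fact (b - a) * (b choose a) = (fact b :: nat)\<close>
        add: mult_ac)
next
  case ("2_2" a)
  have "profile_chains n [a] = (\<lambda>A. [A]) ` {A. A \<subseteq> {1..n} \<and> card A = a}"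
    by (auto simp: profile_chains_def map_eq_Cons_conv)
  then have "card (profile_chains n [a]) = n choose a"
    by (simp add: card_image inj_on_def n_subsets)
  then show ?case
    using "2_2" binomial_fact_lemma[of a n] by (simp add: mult_ac)
qed simp

lemma card_profile_chains_pos:
  assumes "sorted_wrt (<) xs" "xs \<noteq> []" "set xs \<subseteq> {..n}"
  shows "card (profile_chains n xs) > 0"
  using card_profile_chains[OF assms] by (metis fact_nonzero gr0I mult_0)

text \<open>Strict log-convexity of the factorial: each further factor \<open>y + d + 1\<close>
  exceeds the matching \<open>x + d + 1\<close>.\<close>

lemma fact_mult_fact_less:
  assumes "x < y" "0 < d"
  shows "fact (x + d) * fact y < (fact x * fact (y + d) :: nat)"
  using assms(2)
proof (induction d rule: nat_induct_non_zero)
  case 1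
  then show ?case using assms(1) by (simp add: algebra_simps)
next
  case (Suc d)
  have "fact (x + Suc d) * fact y = (x + d + 1) * (fact (x + d) * fact y)"
    by (simp add: algebra_simps)
  also have "\<dots> < (y + d + 1) * (fact x * fact (y + d) :: nat)"
    using assms(1) Suc.IH by (intro mult_less_le_imp_less) auto
  finally show ?case by (simp add: algebra_simps)
qed

section \<open>Windows of consecutive levels\<close>

text \<open>Strictly increasing lists encode the \<open>l\<close>-subsets of a set of
  levels.\<close>

definition profiles :: "nat \<Rightarrow> nat set \<Rightarrow> nat list set" where
  "profiles l T = {xs. sorted_wrt (<) xs \<and> length xs = l \<and> set xs \<subseteq> T}"

text \<open>For finite \<open>T\<close>, the number of \<open>l\<close>-chains of the whole power
  set of \<open>{1..n}\<close> with all sizes in \<open>T\<close>.\<close>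

definition weight :: "nat \<Rightarrow> nat \<Rightarrow> nat set \<Rightarrow> nat" where
  "weight n l T = (\<Sum>xs\<in>profiles l T. card (profile_chains n xs))"

lemma finite_profiles: "finite T \<Longrightarrow> finite (profiles l T)"
  by (rule finite_subset[OF _ finite_lists_length_eq[of T l]]) (auto simp: profiles_def)

lemma weight_mono: "finite U \<Longrightarrow> T \<subseteq> U \<Longrightarrow> weight n l T \<le> weight n l U"
  unfolding weight_def by (rule sum_mono2) (auto simp: finite_profiles, auto simp: profiles_def)

lemma ex_profile:
  assumes "finite T" "a \<in> T" "1 \<le> l" "l \<le> card T"
  obtains xs where "xs \<in> profiles l T" "a \<in> set xs"
proof -
  have "l - 1 \<le> card (T - {a})"
    using assms by simp
  then obtain S where S: "S \<subseteq> T - {a}" "card S = l - 1" "finite S"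
    by (rule obtain_subset_with_card_n)
  define U where "U = insert a S"
  have "finite U" "card U = l" "a \<in> U" "U \<subseteq> T"
    using S assms card_insert_disjoint[of S a] by (auto simp: U_def subset_Diff_insert)
  then have "sorted_list_of_set U \<in> profiles l T" "a \<in> set (sorted_list_of_set U)"
    by (auto simp: profiles_def)
  then show ?thesis ..
qed

text \<open>A level of \<open>U\<close> outside \<open>T\<close> lies on some
  \<open>l\<close>-profile within \<open>U\<close>, and that profile is realised by at least one
  chain.\<close>

lemma weight_less:
  assumes "T \<subset> U" "U \<subseteq> {..n}" "1 \<le> l" "l \<le> card U"
  shows "weight n l T < weight n l U"
proof -
  have fin: "finite U"
    using assms(2) finite_subset by blast
  obtain a where a: "a \<in> U" "a \<notin> T"
    using assms(1) by auto
  obtain xs where xs: "xs \<in> profiles l U" "a \<in> set xs"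
    using ex_profile[OF fin a(1) assms(3,4)] .
  have "card (profile_chains n xs) > 0"
    using xs assms by (intro card_profile_chains_pos) (auto simp: profiles_def)
  then show ?thesis
    unfolding weight_def using xs a assms(1)
    by (intro sum_strict_mono2[of _ _ xs]) (auto simp: fin finite_profiles, auto simp: profiles_def)
qed

section \<open>Comparing neighbouring windows by reflection\<close>

definition reflect :: "nat \<Rightarrow> nat list \<Rightarrow> nat list" where
  "reflect c xs = rev (map (\<lambda>x. c - x) xs)"

lemma sorted_reflect:
  assumes "sorted_wrt (<) xs" "set xs \<subseteq> {..c}"
  shows "sorted_wrt (<) (reflect c xs)"
proof -
  have "sorted_wrt (\<lambda>x y. c - y < c - x) xs"
    using assms(1)
  proof (rule sorted_wrt_mono_rel[rotated])
    fix x y assume "x \<in> set xs" "y \<in> set xs" "x < y"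
    moreover from this have "y \<le> c" using assms(2) by auto
    ultimately show "c - y < c - x" by simp
  qed
  then show ?thesis
    by (simp add: reflect_def sorted_wrt_rev sorted_wrt_map)
qed

text \<open>With this \<open>c\<close>, reflection swaps the levels \<open>i\<close> and
  \<open>i + k + 1\<close> and carries the window \<open>{i..i + k}\<close> to the next one. The gap
  factors cancel from the two multinomial formulas; log-convexity compares the remaining outer
  factorials, according to the side of \<open>n\<close> on which \<open>c\<close> lies.\<close>

lemma card_profile_chains_reflect:
  fixes n k i :: nat
  defines "c \<equiv> 2 * i + k + 1"
  assumes xs: "xs \<in> profiles l {i..i + k}" "i \<in> set xs" and le: "i + k + 1 \<le> n"
  shows "c < n \<Longrightarrow> card (profile_chains n xs) < card (profile_chains n (reflect c xs))"
    and "c = n \<Longrightarrow> card (profile_chains n xs) = card (profile_chains n (reflect c xs))"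
    and "n < c \<Longrightarrow> card (profile_chains n (reflect c xs)) < card (profile_chains n xs)"
proof -
  let ?N = "card (profile_chains n xs)" and ?N' = "card (profile_chains n (reflect c xs))"
  have ne: "xs \<noteq> []" and sorted: "sorted_wrt (<) xs" and sub: "set xs \<subseteq> {i..i + k}"
    using xs by (auto simp: profiles_def)
  have hd: "hd xs = i"
  proof (cases xs)
    case (Cons a ys)
    then show ?thesis using sorted xs(2) sub by force
  qed (use ne in simp)
  have sub_n: "set xs \<subseteq> {..n}"
    using sub le by auto
  \<comment> \<open>\<open>u\<close> is the least entry of the reflected profile. The form
    \<open>n + u - c\<close> is exact whether \<open>c\<close> is below or above
    \<open>n\<close>.\<close>
  define u where "u = c - last xs"
  have "last xs \<in> {i..i + k}"
    using ne sub by (meson last_in_set subsetD)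
  then have u: "i < u" "u \<le> i + k + 1" "last xs = c - u" "n - last xs = n + u - c"
    by (auto simp: u_def c_def)
  have refl: "sorted_wrt (<) (reflect c xs)" "reflect c xs \<noteq> []"
      "set (reflect c xs) \<subseteq> {..n}" "hd (reflect c xs) = u" "last (reflect c xs) = i + k + 1"
  proof -
    show "sorted_wrt (<) (reflect c xs)"
      using sorted sub by (intro sorted_reflect) (auto simp: c_def)
    show "reflect c xs \<noteq> []" "hd (reflect c xs) = u"
      using ne by (auto simp: reflect_def hd_rev last_map u_def)
    show "set (reflect c xs) \<subseteq> {..n}"
      using le sub by (force simp: reflect_def c_def)
    show "last (reflect c xs) = i + k + 1"
      using ne hd by (simp add: reflect_def last_rev hd_map c_def)
  qed
  have "gap_fact (reflect c xs) = gap_fact xs"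
    unfolding reflect_def using sorted sub by (intro gap_fact_reflect) (auto simp: c_def)
  then have "?N * (fact i * gap_fact xs * fact (n + u - c)) =
      ?N' * (fact u * gap_fact xs * fact (n - (i + k + 1)))"
    using card_profile_chains[OF sorted ne sub_n] card_profile_chains[OF refl(1-3)]
    by (simp only: hd u(4) refl(4,5))
  then have "gap_fact xs * (?N * (fact i * fact (n + u - c))) =
      gap_fact xs * (?N' * (fact u * fact (n - (i + k + 1))))"
    by (simp only: mult_ac)
  then have eq: "?N * (fact i * fact (n + u - c)) = ?N' * (fact u * fact (n - (i + k + 1)))"
    using gap_fact_pos[of xs] by simp
  have pos: "?N > 0" "?N' > 0"
    using card_profile_chains_pos[OF sorted ne sub_n] card_profile_chains_pos[OF refl(1-3)] .
  have less: "p < q" if "p * x = q * y" "y < x" "q > 0" for p q x y :: nat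
  proof (rule ccontr)
    assume "\<not> p < q"
    then have "q * x \<le> p * x" by simp
    moreover have "q * y < q * x" using that by simp
    ultimately show False using that by simp
  qed
  show "?N < ?N'" if "c < n"
  proof (rule less[OF eq _ pos(2)])
    have "n - (i + k + 1) = i + (n - c)" "n + u - c = u + (n - c)"
      using that by (auto simp: c_def)
    then show "fact u * fact (n - (i + k + 1)) < (fact i * fact (n + u - c) :: nat)"
      using fact_mult_fact_less[OF u(1), of "n - c"] that by (simp add: mult_ac)
  qed
  show "?N = ?N'" if "c = n"
  proof -
    have "n - (i + k + 1) = i" "n + u - c = u"
      using that by (auto simp: c_def)
    then show ?thesis
      using eq by simp
  qed
  show "?N' < ?N" if "n < c"
  proof (rule less[OF eq[symmetric] _ pos(1)])
    \<comment> \<open>Now the shift goes the other way: \<open>i\<close> and \<open>u\<close> lie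
      \<open>c - n\<close> above \<open>v\<close> and \<open>w\<close>.\<close>
    define v where "v = n - (i + k + 1)"
    define w where "w = n + u - c"
    have "i = v + (c - n)" "u = w + (c - n)" "v < w"
      using that u le by (auto simp: c_def v_def w_def)
    then show "fact i * fact (n + u - c) < (fact u * fact (n - (i + k + 1)) :: nat)"
      using fact_mult_fact_less[of v w "c - n"] that unfolding w_def[symmetric] v_def[symmetric]
      by (simp add: mult_ac)
  qed
qed

text \<open>Profiles using neither \<open>i\<close> nor \<open>i + k + 1\<close> are common to both
  windows. The remaining ones, \<open>Y\<close> and \<open>Z\<close>, are matched by reflection and
  compared term by term.\<close>

lemma weight_window_step:
  fixes n k i l :: nat
  defines "c \<equiv> 2 * i + k + 1"
  assumes l: "1 \<le> l" "l \<le> k + 1" and le: "i + k + 1 \<le> n"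
  shows "c < n \<Longrightarrow> weight n l {i..i + k} < weight n l {i + 1..i + 1 + k}"
    and "c = n \<Longrightarrow> weight n l {i..i + k} = weight n l {i + 1..i + 1 + k}"
    and "n < c \<Longrightarrow> weight n l {i + 1..i + 1 + k} < weight n l {i..i + k}"
proof -
  let ?N = "\<lambda>xs. card (profile_chains n xs)"
  define M where "M = profiles l {i + 1..i + k}"
  define Y where "Y = {xs \<in> profiles l {i..i + k}. i \<in> set xs}"
  define Z where "Z = {xs \<in> profiles l {i + 1..i + 1 + k}. i + k + 1 \<in> set xs}"
  have fin: "finite M" "finite Y" "finite Z"
    by (auto simp: M_def Y_def Z_def finite_profiles)
  have interval: "x \<in> {i + 1..i + k} \<longleftrightarrow> x \<in> {i..i + k} \<and> x \<noteq> i"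
      "x \<in> {i + 1..i + k} \<longleftrightarrow> x \<in> {i + 1..i + 1 + k} \<and> x \<noteq> i + k + 1" for x
    by auto
  have "profiles l {i..i + k} = M \<union> Y" "M \<inter> Y = {}"
    unfolding M_def Y_def profiles_def subset_iff interval(1) by auto
  then have W1: "weight n l {i..i + k} = sum ?N M + sum ?N Y"
    using fin by (simp add: weight_def sum.union_disjoint)
  have "profiles l {i + 1..i + 1 + k} = M \<union> Z" "M \<inter> Z = {}"
    unfolding M_def Z_def profiles_def subset_iff interval(2) by auto
  then have W2: "weight n l {i + 1..i + 1 + k} = sum ?N M + sum ?N Z"
    using fin by (simp add: weight_def sum.union_disjoint)
  have invol: "reflect c (reflect c xs) = xs" if "set xs \<subseteq> {..c}" for xs
    using that by (auto simp: reflect_def rev_map intro!: map_idI)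
  have le_c: "set xs \<subseteq> {..c}" if "xs \<in> Y \<union> Z" for xs
    using that by (force simp: Y_def Z_def profiles_def c_def)
  have bij: "bij_betw (reflect c) Y Z"
  proof (rule bij_betw_byWitness[where f' = "reflect c"])
    show "reflect c ` Y \<subseteq> Z"
    proof clarify
      fix xs assume xs: "xs \<in> Y"
      have "c - i = i + k + 1" by (simp add: c_def)
      then have "i + k + 1 \<in> (\<lambda>x. c - x) ` set xs"
        using xs by (metis (no_types, lifting) Y_def image_eqI mem_Collect_eq)
      moreover have "set (reflect c xs) \<subseteq> {i + 1..i + 1 + k}"
        using xs by (force simp: Y_def profiles_def reflect_def c_def)
      ultimately show "reflect c xs \<in> Z"
        using xs sorted_reflect[of xs c] le_c[of xs]
        by (auto simp: Y_def Z_def profiles_def) (auto simp: reflect_def)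
    qed
    show "reflect c ` Z \<subseteq> Y"
    proof clarify
      fix xs assume xs: "xs \<in> Z"
      have "c - (i + k + 1) = i" by (simp add: c_def)
      then have "i \<in> (\<lambda>x. c - x) ` set xs"
        using xs by (metis (no_types, lifting) Z_def image_eqI mem_Collect_eq)
      moreover have "set (reflect c xs) \<subseteq> {i..i + k}"
        using xs by (force simp: Z_def profiles_def reflect_def c_def)
      ultimately show "reflect c xs \<in> Y"
        using xs sorted_reflect[of xs c] le_c[of xs]
        by (auto simp: Y_def Z_def profiles_def) (auto simp: reflect_def)
    qed
  qed (auto intro!: invol le_c)
  then have Z: "sum ?N Z = (\<Sum>xs\<in>Y. ?N (reflect c xs))"
    by (rule sum.reindex_bij_betw[symmetric])
  \<comment> \<open>Strictness of the sums needs a profile through \<open>i\<close>; one exists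
    because \<open>l\<close> is between 1 and the window size \<open>k + 1\<close>.\<close>
  have "Y \<noteq> {}"
    using ex_profile[of "{i..i + k}" i l] l by (auto simp: Y_def)
  note cmp = card_profile_chains_reflect[of _ l i k n, folded c_def, OF _ _ le]
  show "weight n l {i..i + k} < weight n l {i + 1..i + 1 + k}" if "c < n"
    unfolding W1 W2 Z using fin \<open>Y \<noteq> {}\<close> cmp(1)[OF _ _ that]
    by (intro add_strict_left_mono sum_strict_mono) (auto simp: Y_def)
  show "weight n l {i..i + k} = weight n l {i + 1..i + 1 + k}" if "c = n"
    unfolding W1 W2 Z using cmp(2)[OF _ _ that]
    by (intro arg_cong2[where f = "(+)"] refl sum.cong) (auto simp: Y_def)
  show "weight n l {i + 1..i + 1 + k} < weight n l {i..i + k}" if "n < c"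
    unfolding W1 W2 Z using fin \<open>Y \<noteq> {}\<close> cmp(3)[OF _ _ that]
    by (intro add_strict_left_mono sum_strict_mono) (auto simp: Y_def)
qed

text \<open>The starts \<open>m\<close> and \<open>m'\<close> are half of \<open>n - k\<close>,
  rounded down and up. If they differ, then \<open>2 * m + k + 1 = n\<close>, so the two windows are
  mirror images under \<open>n - x\<close>.\<close>

lemma weight_window_centre:
  fixes n k :: nat
  assumes l: "1 \<le> l" "l \<le> k + 1" and k: "k \<le> n"
  defines "m \<equiv> (n - k) div 2" and "m' \<equiv> (n - k + 1) div 2"
  shows "weight n l {m'..m' + k} = weight n l {m..m + k}"
proof (cases "even (n - k)")
  case False
  then obtain j where "n - k = 2 * j + 1"
    by (elim oddE)
  then have "m' = m + 1" "2 * m + k + 1 = n" "m + k + 1 \<le> n"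
    by (auto simp: m_def m'_def)
  then show ?thesis
    using weight_window_step(2)[OF l, of m n] by simp
qed (auto simp: m_def m'_def)

text \<open>Unimodality: with \<open>j\<close> the start of a window, \<open>2 * j + k + 1\<close>
  is below \<open>n\<close> before the lower central start and above \<open>n\<close> from the upper
  one on, so the weights first rise strictly and finally fall strictly.\<close>

lemma weight_window_less:
  assumes l: "1 \<le> l" "l \<le> k + 1" and k: "k \<le> n" and i: "i + k \<le> n"
    and ne: "i \<noteq> (n - k) div 2" "i \<noteq> (n - k + 1) div 2"
  shows "weight n l {i..i + k} < weight n l {(n - k) div 2..(n - k) div 2 + k}"
proof -
  let ?W = "\<lambda>i. weight n l {i..i + k}"
  let ?m = "(n - k) div 2" and ?m' = "(n - k + 1) div 2"
  have up: "?W j < ?W (j + 1)" if "j < ?m" for j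
    using that k l by (intro weight_window_step(1)) auto
  have down: "?W (j + 1) < ?W j" if "?m' \<le> j" "j + k + 1 \<le> n" for j
    using that k l by (intro weight_window_step(3)) auto
  note centre = weight_window_centre[OF l k]
  consider "i < ?m" | "?m' < i"
    using ne by linarith
  then show ?thesis
  proof cases
    case 1
    have "?W i < ?W j" if "i + 1 \<le> j" "j \<le> ?m" for j
      using that
    proof (induction j rule: dec_induct)
      case base
      then show ?case using up[OF 1] by simp
    next
      case (step j)
      then show ?case using up[of j] by simp
    qed
    from this[of ?m] show ?thesis using 1 by simp
  next
    case 2
    have "?W j < ?W ?m'" if "?m' + 1 \<le> j" "j + k \<le> n" for j
      using that
    proof (induction j rule: dec_induct)
      case base
      then show ?case using down[of ?m'] by simp
    next
      case (step j)
      then show ?case using down[of j] by simp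
    qed
    from this[of i] show ?thesis using 2 i centre by simp
  qed
qed

section \<open>Averaging over maximal chains\<close>

text \<open>A permutation \<open>p\<close> encodes the maximal chain formed by the images of
  \<open>{1..a}\<close> for \<open>a\<close> from 0 to \<open>n\<close>; its members with sizes
  \<open>xs\<close> are selected here.\<close>

definition initial_sets :: "(nat \<Rightarrow> nat) \<Rightarrow> nat list \<Rightarrow> nat set list" where
  "initial_sets p xs = map (\<lambda>a. p ` {1..a}) xs"

definition trace :: "nat \<Rightarrow> nat set set \<Rightarrow> (nat \<Rightarrow> nat) \<Rightarrow> nat set" where
  "trace n F p = {a \<in> {..n}. p ` {1..a} \<in> F}"

text \<open>A bijection from \<open>A\<close> to \<open>B\<close> is glued to one between the
  complements in \<open>S\<close>.\<close>

lemma ex_permutes_image_eq: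
  assumes "finite S" "A \<subseteq> S" "B \<subseteq> S" "card A = card B"
  obtains p where "p permutes S" "p ` A = B"
proof -
  have fin: "finite A" "finite B"
    using assms(1-3) finite_subset by blast+
  obtain f where f: "bij_betw f A B"
    using fin assms(4) finite_same_card_bij by blast
  have "card (S - A) = card (S - B)"
    using assms fin by (simp add: card_Diff_subset)
  then obtain g where g: "bij_betw g (S - A) (S - B)"
    using assms(1) finite_same_card_bij[of "S - A" "S - B"] by auto
  define p where "p x = (if x \<in> A then f x else if x \<in> S then g x else x)" for x
  have pA: "bij_betw p A B"
    using f by (subst bij_betw_cong[of _ _ f]) (auto simp: p_def)
  moreover have "bij_betw p (S - A) (S - B)"
    using g by (subst bij_betw_cong[of _ _ g]) (auto simp: p_def)
  ultimately have "bij_betw p (A \<union> (S - A)) (B \<union> (S - B))"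
    by (rule bij_betw_combine) auto
  then have "bij_betw p S S"
    using assms by (simp add: Un_absorb1)
  then have "p permutes S"
    using assms(2) by (intro bij_imp_permutes) (auto simp: p_def)
  then show ?thesis
    using that pA by (auto simp: bij_betw_def)
qed

text \<open>Every chain extends to a maximal one. Members are inserted from the largest down: for a
  new smallest set, \<open>p\<close> is precomposed with a \<open>q\<close> that moves only points
  of \<open>{1..card B}\<close>, where \<open>B\<close> is the next set, so the members already
  placed stay put.\<close>

lemma ex_permutes_chain:
  assumes "sorted_wrt (\<subset>) Gs" "set Gs \<subseteq> Pow {1..n}"
  shows "\<exists>p. p permutes {1..n} \<and> (\<forall>G\<in>set Gs. p ` {1..card G} = G)"
  using assms
proof (induction Gs)
  case Nil
  show ?case by (auto intro: permutes_id)
next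
  case (Cons A Gs)
  then obtain p where p: "p permutes {1..n}" "\<forall>G\<in>set Gs. p ` {1..card G} = G"
    by auto
  \<comment> \<open>The full set serves as the next set for the first member inserted.\<close>
  define B where "B = (if Gs = [] then {1..n} else hd Gs)"
  have B: "B \<subseteq> {1..n}" "p ` {1..card B} = B" "A \<subseteq> B" "\<forall>G\<in>set Gs. B \<subseteq> G"
  proof -
    show "B \<subseteq> {1..n}" "A \<subseteq> B" "\<forall>G\<in>set Gs. B \<subseteq> G"
      using Cons.prems by (cases Gs; auto simp: B_def)+
    show "p ` {1..card B} = B"
      using p by (cases "Gs = []") (simp_all add: B_def permutes_image)
  qed
  have inj: "inj p"
    using p(1) permutes_inj by blast
  \<comment> \<open>\<open>A'\<close> is the place of \<open>A\<close> in the domain of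
    \<open>p\<close>; \<open>q\<close> must carry \<open>{1..card A}\<close> onto it.\<close>
  define A' where "A' = p -` A"
  have A': "p ` A' = A"
    using permutes_surj[OF p(1)] by (simp add: A'_def image_vimage_eq)
  have "A' \<subseteq> {1..card B}"
    using B(2,3) A' inj by (metis inj_image_subset_iff)
  moreover have "card A' = card A"
    using A' inj card_image by (metis inj_on_subset subset_UNIV)
  moreover have "card A \<le> card B"
    using B(1,3) by (intro card_mono finite_subset[OF B(1)]) auto
  ultimately obtain q where q: "q permutes {1..card B}" "q ` {1..card A} = A'"
    by (elim ex_permutes_image_eq[of "{1..card B}" "{1..card A}" A', rotated -1]) auto
  have "card B \<le> n"
    using B(1) card_mono[of "{1..n}" B] by simp
  then have q_permutes: "q permutes {1..c}" if "card B \<le> c" for c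
    using that q(1) by (elim permutes_subset) auto
  have "(p \<circ> q) ` {1..card G} = G" if "G \<in> set (A # Gs)" for G
  proof (cases "G = A")
    case True
    then show ?thesis using q A' by (simp add: image_comp flip: image_image)
  next
    case False
    then have G: "G \<in> set Gs" using that by simp
    then have "card B \<le> card G"
      using B(4) Cons.prems(2) finite_subset[of G "{1..n}"] by (intro card_mono) auto
    then have "q ` {1..card G} = {1..card G}"
      using q_permutes permutes_image by blast
    then show ?thesis using p G by (simp flip: image_image)
  qed
  moreover have "(p \<circ> q) permutes {1..n}"
    using q_permutes[OF \<open>card B \<le> n\<close>] p(1) by (rule permutes_compose)
  ultimately show ?case by blast
qed

lemma card_permutes_initial:
  assumes "p permutes {1..n}" "a \<le> n"
  shows "p ` {1..a} \<subseteq> {1..n}" "card (p ` {1..a}) = a"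
proof -
  show "p ` {1..a} \<subseteq> {1..n}"
    using assms(2) image_mono[of "{1..a}" "{1..n}" p] permutes_image[OF assms(1)] by simp
  show "card (p ` {1..a}) = a"
    using permutes_inj_on[OF assms(1)] by (simp add: card_image)
qed

lemma initial_sets_profile:
  assumes "p permutes {1..n}" "sorted_wrt (<) xs" "set xs \<subseteq> {..n}"
  shows "initial_sets p xs \<in> profile_chains n xs"
proof -
  have "sorted_wrt (\<lambda>a b. p ` {1..a} \<subset> p ` {1..b}) xs"
    using assms(2)
  proof (rule sorted_wrt_mono_rel[rotated])
    fix a b assume "a \<in> set xs" "b \<in> set xs" "a < b"
    then have "card (p ` {1..a}) \<noteq> card (p ` {1..b})"
      using assms card_permutes_initial[OF assms(1)] by (metis atMost_iff less_irrefl subsetD)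
    moreover have "p ` {1..a} \<subseteq> p ` {1..b}"
      using \<open>a < b\<close> by auto
    ultimately show "p ` {1..a} \<subset> p ` {1..b}" by auto
  qed
  then have "sorted_wrt (\<subset>) (initial_sets p xs)"
    by (simp add: initial_sets_def sorted_wrt_map)
  moreover have "set (initial_sets p xs) \<subseteq> Pow {1..n}"
    using card_permutes_initial(1)[OF assms(1)] assms(3) by (fastforce simp: initial_sets_def)
  moreover have "map card (initial_sets p xs) = xs"
    using card_permutes_initial(2)[OF assms(1)] assms(3)
    by (auto simp: initial_sets_def intro!: map_idI)
  ultimately show ?thesis
    by (simp add: profile_chains_def)
qed

text \<open>The permutations act transitively on the chains of a given profile, so the maximal chains
  are equidistributed over them.\<close>

lemma card_permutes_initial_sets:
  fixes n :: nat and xs :: "nat list" and F :: "nat set set"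
  defines "P \<equiv> {p. p permutes {1..n}}"
  assumes xs: "sorted_wrt (<) xs" "set xs \<subseteq> {..n}"
  shows "card (profile_chains n xs) * card {p \<in> P. set (initial_sets p xs) \<subseteq> F} =
         fact n * card {Gs \<in> profile_chains n xs. set Gs \<subseteq> F}"
proof -
  define fibre where "fibre Gs = {p \<in> P. initial_sets p xs = Gs}" for Gs
  \<comment> \<open>The fibre of the standard chain is the reference; all others turn out to have
    the same size.\<close>
  define r where "r = card (fibre (initial_sets id xs))"
  have finP: "finite P"
    by (simp add: P_def finite_permutations)
  have fibre: "card (fibre Gs) = r" if "Gs \<in> profile_chains n xs" for Gs
  proof -
    have Gs: "sorted_wrt (\<subset>) Gs" "set Gs \<subseteq> Pow {1..n}" "map card Gs = xs"
      using that by (auto simp: profile_chains_def)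
    obtain p where p: "p permutes {1..n}" "\<forall>G\<in>set Gs. p ` {1..card G} = G"
      using ex_permutes_chain[OF Gs(1,2)] by blast
    have pxs: "initial_sets p xs = Gs"
      using p(2) by (auto simp: initial_sets_def Gs(3)[symmetric] intro!: map_idI)
    have comp: "initial_sets (f \<circ> g) xs = map ((`) f) (initial_sets g xs)" for f g
      by (simp add: initial_sets_def image_comp)
    have inv: "inv p \<circ> p = id" "p \<circ> inv p = id"
      using permutes_inv_o[OF p(1)] by auto
    \<comment> \<open>Left composition with \<open>p\<close> carries the standard chain to
      \<open>Gs\<close>.\<close>
    have "bij_betw (\<lambda>q. p \<circ> q) (fibre (initial_sets id xs)) (fibre Gs)"
    proof (rule bij_betw_byWitness[where f' = "\<lambda>q. inv p \<circ> q"])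
      show "(\<lambda>q. p \<circ> q) ` fibre (initial_sets id xs) \<subseteq> fibre Gs"
        using p pxs comp[of p] comp[of p id]
        by (auto simp: fibre_def P_def intro: permutes_compose)
      show "(\<lambda>q. inv p \<circ> q) ` fibre Gs \<subseteq> fibre (initial_sets id xs)"
        using p pxs comp[of "inv p"] comp[of "inv p" p] inv
        by (auto simp: fibre_def P_def intro: permutes_compose permutes_inv)
    qed (auto simp: inv comp_assoc[symmetric])
    then show ?thesis
      by (simp add: r_def bij_betw_same_card)
  qed
  have count: "card {p \<in> P. initial_sets p xs \<in> Q} = r * card Q"
    if "Q \<subseteq> profile_chains n xs" for Q
  proof -
    have "{p \<in> P. initial_sets p xs \<in> Q} = (\<Union>Gs\<in>Q. fibre Gs)"
      by (auto simp: fibre_def)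
    also have "card \<dots> = (\<Sum>Gs\<in>Q. card (fibre Gs))"
      using that finP finite_subset[OF that finite_profile_chains]
      by (intro card_UN_disjoint) (auto simp: fibre_def)
    also have "\<dots> = (\<Sum>Gs\<in>Q. r)"
      using that fibre by (intro sum.cong) auto
    finally show ?thesis by simp
  qed
  have mem: "initial_sets p xs \<in> profile_chains n xs" if "p \<in> P" for p
    using that initial_sets_profile xs by (simp add: P_def)
  \<comment> \<open>\<open>count\<close> is used twice: all chains of the profile give
    \<open>fact n\<close>, those inside \<open>F\<close> give the other factor. Thus
    \<open>r\<close> is never computed.\<close>
  have "{p \<in> P. initial_sets p xs \<in> profile_chains n xs} = P"
    using mem by auto
  moreover have "card P = fact n"
    by (simp add: P_def card_permutations)
  ultimately have "fact n = r * card (profile_chains n xs)"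
    using count[of "profile_chains n xs"] by simp
  moreover have "{p \<in> P. set (initial_sets p xs) \<subseteq> F} =
      {p \<in> P. initial_sets p xs \<in> {Gs \<in> profile_chains n xs. set Gs \<subseteq> F}}"
    using mem by auto
  ultimately show ?thesis
    using count[of "{Gs \<in> profile_chains n xs. set Gs \<subseteq> F}"] by simp
qed

section \<open>Counting chains as an average of weights\<close>

lemma sorted_psubset_unique:
  assumes "sorted_wrt (\<subset>) Gs" "sorted_wrt (\<subset>) Hs" "set Gs = set Hs"
  shows "Gs = Hs"
  using assms
proof (induction Gs arbitrary: Hs)
  case (Cons G Gs)
  then obtain H Hs' where Hs: "Hs = H # Hs'"
    by (cases Hs) auto
  have "G \<in> set (H # Hs')" "H \<in> set (G # Gs)"
    using Cons.prems Hs by auto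
  \<comment> \<open>Otherwise each head would be strictly contained in the other.\<close>
  then have "G = H"
    using Cons.prems Hs by auto
  moreover have "G \<notin> set Gs" "H \<notin> set Hs'"
    using Cons.prems Hs by auto
  ultimately have "set Gs = set Hs'"
    using Cons.prems(3) Hs by (metis insert_ident list.simps(15))
  then show ?case
    using Cons.IH[of Hs'] Cons.prems Hs \<open>G = H\<close> by simp
qed auto

lemma sorted_map_card:
  assumes "sorted_wrt (\<subset>) Gs" "set Gs \<subseteq> Pow {1..n}"
  shows "sorted_wrt (<) (map card Gs)" "set (map card Gs) \<subseteq> {..n}"
proof -
  have "sorted_wrt (\<lambda>A B. card A < card B) Gs"
    using assms(1)
  proof (rule sorted_wrt_mono_rel[rotated])
    fix A B assume "B \<in> set Gs" "A \<subset> B"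
    then show "card A < card B"
      using assms(2) finite_subset[of B "{1..n}"] by (intro psubset_card_mono) auto
  qed
  then show "sorted_wrt (<) (map card Gs)"
    by (simp add: sorted_wrt_map)
  show "set (map card Gs) \<subseteq> {..n}"
    using assms(2) card_mono[of "{1..n}"] by auto
qed

text \<open>Each chain has exactly one increasing listing, so unordered chains are counted as lists
  and then classified by their sizes.\<close>

lemma num_chains_eq_sum:
  assumes "F \<subseteq> Pow {1..n}"
  shows "num_chains n l F =
    (\<Sum>xs\<in>profiles l {..n}. card {Gs \<in> profile_chains n xs. set Gs \<subseteq> F})"
proof -
  let ?L = "{Gs. length Gs = l \<and> sorted_wrt (\<subset>) Gs \<and> set Gs \<subseteq> F}"
  have "{C. is_chain n l C \<and> C \<subseteq> F} = set ` ?L"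
    using assms by (auto simp: is_chain_def)
  moreover have "inj_on set ?L"
    by (auto simp: inj_on_def intro: sorted_psubset_unique)
  ultimately have "num_chains n l F = card ?L"
    by (simp add: num_chains_def card_image)
  also have "?L = (\<Union>xs\<in>profiles l {..n}. {Gs \<in> profile_chains n xs. set Gs \<subseteq> F})"
  proof (intro equalityI subsetI)
    fix Gs assume Gs: "Gs \<in> ?L"
    then have sub: "set Gs \<subseteq> Pow {1..n}"
      using assms by blast
    then have "map card Gs \<in> profiles l {..n}"
      using Gs sorted_map_card[of Gs n] by (simp add: profiles_def)
    moreover have "Gs \<in> {Hs \<in> profile_chains n (map card Gs). set Hs \<subseteq> F}"
      using Gs sub by (simp add: profile_chains_def)
    ultimately show "Gs \<in> (\<Union>xs\<in>profiles l {..n}. {Gs \<in> profile_chains n xs. set Gs \<subseteq> F})"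
      by blast
  qed (auto simp: profiles_def profile_chains_def)
  also have "card \<dots> =
      (\<Sum>xs\<in>profiles l {..n}. card {Gs \<in> profile_chains n xs. set Gs \<subseteq> F})"
    by (intro card_UN_disjoint)
      (auto simp: finite_profiles finite_profile_chains, auto simp: profile_chains_def)
  finally show ?thesis .
qed

text \<open>The averaging identity, multiplied by \<open>fact n\<close> to stay in the naturals. It
  double counts pairs of a permutation and a profile, each weighted by the number of chains with
  that profile.\<close>

lemma fact_num_chains:
  fixes n :: nat
  defines "P \<equiv> {p. p permutes {1..n}}"
  assumes "F \<subseteq> Pow {1..n}"
  shows "fact n * num_chains n l F = (\<Sum>p\<in>P. weight n l (trace n F p))"
proof -
  let ?X = "profiles l {..n}" and ?N = "\<lambda>xs. card (profile_chains n xs)"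
  have finP: "finite P"
    by (simp add: P_def finite_permutations)
  have "fact n * num_chains n l F =
      (\<Sum>xs\<in>?X. fact n * card {Gs \<in> profile_chains n xs. set Gs \<subseteq> F})"
    by (simp add: num_chains_eq_sum[OF assms(2)] sum_distrib_left)
  also have "\<dots> = (\<Sum>xs\<in>?X. ?N xs * card {p \<in> P. set (initial_sets p xs) \<subseteq> F})"
    unfolding P_def
    by (intro sum.cong refl card_permutes_initial_sets[symmetric]) (auto simp: profiles_def)
  also have "\<dots> = (\<Sum>xs\<in>?X. \<Sum>p\<in>P. if set (initial_sets p xs) \<subseteq> F then ?N xs else 0)"
    using finP by (simp add: mult.commute flip: sum.inter_filter)
  also have "\<dots> = (\<Sum>p\<in>P. \<Sum>xs\<in>?X. if set (initial_sets p xs) \<subseteq> F then ?N xs else 0)"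
    by (rule sum.swap)
  also have "\<dots> = (\<Sum>p\<in>P. \<Sum>xs\<in>{xs \<in> ?X. set (initial_sets p xs) \<subseteq> F}. ?N xs)"
    by (simp add: finite_profiles sum.inter_filter)
  \<comment> \<open>The members of the maximal chain with sizes \<open>xs\<close> all lie in
    \<open>F\<close> iff the entries of \<open>xs\<close> lie in the trace.\<close>
  also have "\<dots> = (\<Sum>p\<in>P. weight n l (trace n F p))"
    unfolding weight_def
    by (intro sum.cong refl) (auto simp: profiles_def trace_def initial_sets_def)
  finally show ?thesis .
qed

section \<open>Extremal families\<close>

definition window_family :: "nat \<Rightarrow> nat \<Rightarrow> nat \<Rightarrow> nat set set" where
  "window_family n k i = {A. A \<subseteq> {1..n} \<and> card A \<in> {i..i + k}}"

text \<open>Every maximal chain has the same trace, the whole window, so the average is a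
  constant.\<close>

lemma num_chains_window:
  assumes "i + k \<le> n"
  shows "num_chains n l (window_family n k i) = weight n l {i..i + k}"
proof -
  have "trace n (window_family n k i) p = {i..i + k}" if p: "p permutes {1..n}" for p
  proof -
    have "p ` {1..a} \<in> window_family n k i \<longleftrightarrow> a \<in> {i..i + k}" if "a \<le> n" for a
      unfolding window_family_def using card_permutes_initial[OF p that] by simp
    then show ?thesis
      using assms by (auto simp: trace_def)
  qed
  moreover have "window_family n k i \<subseteq> Pow {1..n}"
    by (auto simp: window_family_def)
  ultimately have "fact n * num_chains n l (window_family n k i) = fact n * weight n l {i..i + k}"
    by (simp add: fact_num_chains card_permutations)
  then show ?thesis by simp
qed

lemma gap_bounded_window: "gap_bounded n k (window_family n k i)"
proof -
  have "card (B - A) \<le> k"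
    if "A \<in> window_family n k i" "B \<in> window_family n k i" "A \<subset> B" for A B
  proof -
    have "finite A"
      using that(1) finite_subset[of A "{1..n}"] by (simp add: window_family_def)
    then have "card (B - A) = card B - card A"
      using that by (intro card_Diff_subset) auto
    then show ?thesis
      using that by (auto simp: window_family_def)
  qed
  moreover have "window_family n k i \<subseteq> Pow {1..n}"
    by (auto simp: window_family_def)
  ultimately show ?thesis
    unfolding gap_bounded_def by (meson not_less)
qed

text \<open>Two members of \<open>F\<close> on one maximal chain are comparable, so their levels
  differ by at most \<open>k\<close>.\<close>

lemma trace_window:
  assumes F: "gap_bounded n k F" and p: "p permutes {1..n}" and k: "k \<le> n"
  obtains i where "i + k \<le> n" "trace n F p \<subseteq> {i..i + k}"
proof (cases "trace n F p = {}")
  case True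
  then show ?thesis using that[of 0] k by simp
next
  case False
  let ?T = "trace n F p"
  have fin: "finite ?T" by (simp add: trace_def)
  \<comment> \<open>The cap \<open>n - k\<close> keeps the window inside \<open>{..n}\<close>; a
    capped window ends at \<open>n\<close> and so still covers the trace.\<close>
  define i where "i = min (Min ?T) (n - k)"
  have "b \<le> Min ?T + k" if "b \<in> ?T" for b
  proof (rule ccontr)
    let ?a = "Min ?T"
    assume b: "\<not> b \<le> ?a + k"
    have a: "?a \<in> ?T" using Min_in fin False by blast
    have sub: "p ` {1..?a} \<subseteq> p ` {1..b}" using b by auto
    have "?a \<le> n" "b \<le> n"
      using a that by (auto simp: trace_def)
    then have "card (p ` {1..b} - p ` {1..?a}) = b - ?a"
      using sub card_permutes_initial(2)[OF p] by (simp add: card_Diff_subset)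
    then have gap: "k < card (p ` {1..b} - p ` {1..?a})"
      using b by simp
    then have "p ` {1..b} - p ` {1..?a} \<noteq> {}"
      by (metis card.empty not_less_zero)
    then have "p ` {1..?a} \<subset> p ` {1..b}"
      using sub by blast
    moreover have "p ` {1..?a} \<in> F" "p ` {1..b} \<in> F"
      using a that by (simp_all add: trace_def)
    ultimately show False
      using F gap unfolding gap_bounded_def by blast
  qed
  moreover have "\<forall>b\<in>?T. Min ?T \<le> b" "\<forall>b\<in>?T. b \<le> n"
    using fin by (auto simp: trace_def)
  ultimately have "Min ?T \<le> b \<and> b \<le> Min ?T + k \<and> b \<le> n" if "b \<in> ?T" for b
    using that by simp
  then have "i \<le> b \<and> b \<le> i + k" if "b \<in> ?T" for b
    using that k unfolding i_def by fastforce
  then have "?T \<subseteq> {i..i + k}"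
    by auto
  moreover have "i + k \<le> n"
    using k unfolding i_def by linarith
  ultimately show ?thesis using that by blast
qed

text \<open>Two inequalities are chained, from the trace to its window and from there to the central
  window. Equal weights force equality in both, so the trace fills a window and that window is
  central.\<close>

lemma weight_trace_le:
  assumes F: "gap_bounded n k F" and p: "p permutes {1..n}" and k: "k \<le> n"
    and l: "1 \<le> l" "l \<le> k + 1"
  defines "m \<equiv> (n - k) div 2" and "m' \<equiv> (n - k + 1) div 2"
  shows "weight n l (trace n F p) \<le> weight n l {m..m + k}"
    and "weight n l (trace n F p) = weight n l {m..m + k} \<Longrightarrow>
      trace n F p \<in> {{m..m + k}, {m'..m' + k}}"
proof -
  obtain i where i: "i + k \<le> n" "trace n F p \<subseteq> {i..i + k}"
    using trace_window[OF F p k] .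
  have le: "weight n l (trace n F p) \<le> weight n l {i..i + k}"
    using i by (intro weight_mono) auto
  have less: "weight n l {i..i + k} < weight n l {m..m + k}" if "i \<noteq> m" "i \<noteq> m'"
    using weight_window_less[OF l k i(1)] that by (simp add: m_def m'_def)
  have sub: "weight n l (trace n F p) < weight n l {i..i + k}" if "trace n F p \<noteq> {i..i + k}"
    using that i l by (intro weight_less) auto
  have "weight n l {m'..m' + k} = weight n l {m..m + k}"
    using weight_window_centre[OF l k] by (simp add: m_def m'_def)
  then have le': "weight n l {i..i + k} \<le> weight n l {m..m + k}"
    using less by (cases "i = m \<or> i = m'") auto
  then show "weight n l (trace n F p) \<le> weight n l {m..m + k}"
    using le by simp
  show "trace n F p \<in> {{m..m + k}, {m'..m' + k}}"
    if "weight n l (trace n F p) = weight n l {m..m + k}"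
    using that sub less le le' by (cases "trace n F p = {i..i + k}") auto
qed

section \<open>Recovering the family from its traces\<close>

lemma ex_permutes_pair:
  assumes "A \<subseteq> B" "B \<subseteq> {1..n}"
  obtains p where "p permutes {1..n}" "p ` {1..card A} = A" "p ` {1..card B} = B"
proof (cases "A = B")
  case True
  then show ?thesis
    using ex_permutes_chain[of "[A]" n] assms that by auto
next
  case False
  then have "sorted_wrt (\<subset>) [A, B]" "set [A, B] \<subseteq> Pow {1..n}"
    using assms by auto
  then show ?thesis
    using ex_permutes_chain[of "[A, B]" n] that by auto
qed

text \<open>Connectivity of the Johnson graph: exchanging a point of \<open>A - B\<close> for one of
  \<open>B - A\<close> is an allowed step and brings \<open>A\<close> closer to
  \<open>B\<close>.\<close>

lemma same_size_connected:
  assumes swap: "\<And>A B. A \<subseteq> S \<Longrightarrow> B \<subseteq> S \<Longrightarrow> card A = m \<Longrightarrow> card B = m \<Longrightarrow>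
      card (A \<union> B) \<le> m + 1 \<Longrightarrow> Q A \<Longrightarrow> Q B"
    and S: "finite S" and A: "A \<subseteq> S" "card A = m" "Q A" and B: "B \<subseteq> S" "card B = m"
  shows "Q B"
  using A
proof (induction "card (A - B)" arbitrary: A)
  case 0
  have fin: "finite A" "finite B"
    using 0(2) B(1) S finite_subset by blast+
  then have "A \<subseteq> B"
    using 0 by auto
  then have "A = B"
    using 0 B fin card_subset_eq by metis
  then show ?case using 0 by simp
next
  case (Suc d)
  have fin: "finite A" "finite B"
    using Suc.prems(1) B(1) S finite_subset by blast+
  have "card (B - A) = card (A - B)"
    using fin B(2) Suc.prems(2) by (simp add: card_Diff_subset_Int Int_commute)
  then have "A - B \<noteq> {}" "B - A \<noteq> {}"
    using Suc.hyps(2) by (metis card.empty nat.distinct(1))+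
  then obtain x y where x: "x \<in> A" "x \<notin> B" and y: "y \<in> B" "y \<notin> A"
    by blast
  define C where "C = insert y (A - {x})"
  have "card C = m"
    using x y fin Suc.prems(2) card_Suc_Diff1[OF fin(1) x(1)] by (simp add: C_def)
  moreover have "C \<subseteq> S"
    using Suc.prems B y by (auto simp: C_def)
  moreover have "A \<union> C = insert y A"
    using x by (auto simp: C_def)
  ultimately have "Q C"
    using Suc.prems y fin by (intro swap[of A C]) auto
  have "C - B = (A - B) - {x}"
    using y by (auto simp: C_def)
  then have "card (C - B) = d"
    using Suc.hyps(2) x fin by simp
  then show ?case
    using Suc.hyps(1)[of C] \<open>card C = m\<close> \<open>C \<subseteq> S\<close> \<open>Q C\<close> by simp
qed

text \<open>A priori the window may vary with \<open>p\<close>. When there are two candidates,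
  membership in \<open>F\<close> is shown to be constant on the sets of size \<open>m\<close>, which
  fixes the window for all \<open>p\<close> at once.\<close>

lemma traces_determine_family:
  assumes F: "F \<subseteq> Pow {1..n}" and k: "k \<le> n"
  defines "m \<equiv> (n - k) div 2" and "m' \<equiv> (n - k + 1) div 2"
  assumes trace: "\<And>p. p permutes {1..n} \<Longrightarrow> trace n F p \<in> {{m..m + k}, {m'..m' + k}}"
  shows "F = window_family n k m \<or> F = window_family n k m'"
proof -
  \<comment> \<open>A window common to all \<open>p\<close> settles the family, because every set
    lies on some maximal chain.\<close>
  have eqI: "F = window_family n k i"
    if tr: "\<And>p. p permutes {1..n} \<Longrightarrow> trace n F p = {i..i + k}" for i
  proof -
    have "A \<in> F \<longleftrightarrow> card A \<in> {i..i + k}" if "A \<subseteq> {1..n}" for A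
    proof -
      obtain p where p: "p permutes {1..n}" "p ` {1..card A} = A"
        using ex_permutes_pair[OF subset_refl \<open>A \<subseteq> {1..n}\<close>] .
      have "card A \<le> n"
        using that card_mono[of "{1..n}" A] by simp
      then have "A \<in> F \<longleftrightarrow> card A \<in> trace n F p"
        using p by (simp add: trace_def)
      then show ?thesis using tr[OF p(1)] by simp
    qed
    then show ?thesis
      using F by (auto simp: window_family_def)
  qed
  show ?thesis
  proof (cases "m' = m")
    case True
    then show ?thesis using eqI[of m] trace by simp
  next
    case False
    then have "odd (n - k)"
      unfolding m_def m'_def by presburger
    then obtain j where "n - k = 2 * j + 1"
      by (elim oddE)
    then have m: "m' = m + 1" "m + k + 1 \<le> n"
      by (auto simp: m_def m'_def)
    \<comment> \<open>Each candidate window contains exactly one of the levels \<open>m\<close> and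
      \<open>m + k + 1\<close>; this is applied to a maximal chain through \<open>A\<close> and
      \<open>B\<close>.\<close>
    have dichotomy: "A \<in> F \<longleftrightarrow> B \<notin> F"
      if AB: "A \<subseteq> B" "B \<subseteq> {1..n}" "card A = m" "card B = m + k + 1" for A B
    proof -
      obtain p where p: "p permutes {1..n}" "p ` {1..card A} = A" "p ` {1..card B} = B"
        using ex_permutes_pair[OF AB(1,2)] .
      have iff: "A \<in> F \<longleftrightarrow> m \<in> trace n F p" "B \<in> F \<longleftrightarrow> m + k + 1 \<in> trace n F p"
        using p(2,3) AB(3,4) m(2) by (simp_all add: trace_def)
      consider "trace n F p = {m..m + k}" | "trace n F p = {m'..m' + k}"
        using trace[OF p(1)] by blast
      then show ?thesis
        by cases (simp_all add: iff m(1))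
    qed
    \<comment> \<open>Two neighbouring \<open>m\<close>-sets have a common superset \<open>B\<close>
      of size \<open>m + k + 1\<close>, and by \<open>dichotomy\<close> both disagree with
      \<open>B\<close>.\<close>
    have swap: "A' \<in> F \<longleftrightarrow> b" if sw: "A \<subseteq> {1..n}" "A' \<subseteq> {1..n}" "card A = m" "card A' = m"
      "card (A \<union> A') \<le> m + 1" "A \<in> F \<longleftrightarrow> b" for A A' b
    proof -
      have "card (A \<union> A') \<le> m + k + 1" "m + k + 1 \<le> card {1..n}" "A \<union> A' \<subseteq> {1..n}"
        using sw(1,2,5) m by simp_all
      from exists_subset_between[OF this finite_atLeastAtMost]
      obtain B where B: "A \<union> A' \<subseteq> B" "B \<subseteq> {1..n}" "card B = m + k + 1"
        by blast
      then have "A \<in> F \<longleftrightarrow> B \<notin> F" "A' \<in> F \<longleftrightarrow> B \<notin> F"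
        using sw(3,4) by (simp_all add: dichotomy)
      then show ?thesis
        using sw(6) by simp
    qed
    have const: "A \<in> F \<longleftrightarrow> {1..m} \<in> F" if A: "A \<subseteq> {1..n}" "card A = m" for A
    proof (rule same_size_connected[where Q = "\<lambda>A. A \<in> F \<longleftrightarrow> {1..m} \<in> F" and A = "{1..m}"])
      show "C \<in> F \<longleftrightarrow> {1..m} \<in> F"
        if "B \<subseteq> {1..n}" "C \<subseteq> {1..n}" "card B = m" "card C = m" "card (B \<union> C) \<le> m + 1"
          "B \<in> F \<longleftrightarrow> {1..m} \<in> F" for B C
        using that by (rule swap)
    qed (use A m in simp_all)
    have tr: "m \<in> trace n F p \<longleftrightarrow> {1..m} \<in> F" if "p permutes {1..n}" for p
      using const[of "p ` {1..m}"] card_permutes_initial[OF that, of m] m by (simp add: trace_def)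
    show ?thesis
    proof (cases "{1..m} \<in> F")
      case True
      have "trace n F p = {m..m + k}" if "p permutes {1..n}" for p
        using trace[OF that] tr[OF that] True m(1) by fastforce
      then show ?thesis using eqI by blast
    next
      case False
      have "trace n F p = {m'..m' + k}" if "p permutes {1..n}" for p
        using trace[OF that] tr[OF that] False m(1) by fastforce
      then show ?thesis using eqI by blast
    qed
  qed
qed

text \<open>By averaging, the weight of a central window bounds every admissible family, and both
  central windows attain it. A sum of terms with a common bound is maximal only if every term is, so
  all traces of a maximiser are central windows.\<close>

lemma is_arg_max_num_chains_iff:
  assumes k: "k \<le> n" and l: "1 \<le> l" "l \<le> k + 1"
  shows "is_arg_max (num_chains n l) (gap_bounded n k) F \<longleftrightarrow>
    F = window_family n k ((n - k) div 2) \<or> F = window_family n k ((n - k + 1) div 2)"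
    (is "_ \<longleftrightarrow> F = window_family n k ?m \<or> F = window_family n k ?m'")
proof -
  let ?W = "weight n l {?m..?m + k}"
  have num: "num_chains n l (window_family n k ?m) = ?W"
      "num_chains n l (window_family n k ?m') = ?W"
  proof -
    have "?m + k \<le> n" "?m' + k \<le> n"
      using k l by presburger+
    then show "num_chains n l (window_family n k ?m) = ?W"
        "num_chains n l (window_family n k ?m') = ?W"
      using weight_window_centre[OF l k] by (simp_all add: num_chains_window)
  qed
  have le: "num_chains n l G \<le> ?W" if "gap_bounded n k G" for G
  proof -
    have "fact n * num_chains n l G = (\<Sum>p | p permutes {1..n}. weight n l (trace n G p))"
      using that by (intro fact_num_chains) (simp add: gap_bounded_def)
    also have "\<dots> \<le> (\<Sum>p | p permutes {1..n}. ?W)"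
      using weight_trace_le(1)[OF that _ k l] by (intro sum_mono) simp
    also have "\<dots> = fact n * ?W"
      by (simp add: card_permutations)
    finally show ?thesis by simp
  qed
  have max: "is_arg_max (num_chains n l) (gap_bounded n k) F \<longleftrightarrow>
      gap_bounded n k F \<and> num_chains n l F = ?W"
    unfolding is_arg_max_def using le num(1) gap_bounded_window[of n k ?m]
    by (metis le_antisym not_le)
  show ?thesis
  proof
    assume "is_arg_max (num_chains n l) (gap_bounded n k) F"
    then have F: "gap_bounded n k F" "num_chains n l F = ?W"
      using max by auto
    then have sub: "F \<subseteq> Pow {1..n}"
      by (simp add: gap_bounded_def)
    have eq: "(\<Sum>p | p permutes {1..n}. weight n l (trace n F p)) =
        (\<Sum>p | p permutes {1..n}. ?W)"
      using fact_num_chains[OF sub, of l] F(2) by (simp add: card_permutations)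
    show "F = window_family n k ?m \<or> F = window_family n k ?m'"
    proof (rule traces_determine_family[OF sub k])
      fix p assume p: "p permutes {1..n}"
      have "weight n l (trace n F p) = ?W"
      proof (rule sum_mono_inv[OF eq])
        show "weight n l (trace n F q) \<le> ?W" if "q \<in> {p. p permutes {1..n}}" for q
          using that by (intro weight_trace_le(1)[OF F(1) _ k l]) simp
      qed (use p in \<open>simp_all add: finite_permutations\<close>)
      then show "trace n F p \<in> {{?m..?m + k}, {?m'..?m' + k}}"
        by (rule weight_trace_le(2)[OF F(1) p k l])
    qed
  next
    assume "F = window_family n k ?m \<or> F = window_family n k ?m'"
    then have "gap_bounded n k F" "num_chains n l F = ?W"
      using num gap_bounded_window by blast+
    then show "is_arg_max (num_chains n l) (gap_bounded n k) F"
      unfolding max ..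
  qed
qed

section \<open>The rounded bounds and the case of large \<open>k\<close>\<close>

lemma lower_family_eq: "k \<le> n \<Longrightarrow> lower_family n k = window_family n k ((n - k) div 2)"
proof -
  assume k: "k \<le> n"
  \<comment> \<open>The unrounded bounds differ by the integer \<open>k\<close>, hence so do the
    rounded ones.\<close>
  have "\<lfloor>(real n - real k) / 2\<rfloor> = int ((n - k) div 2)"
       "\<lfloor>(real n + real k) / 2\<rfloor> = int ((n - k) div 2 + k)"
    using k by (simp_all add: floor_eq_iff) linarith+
  then show ?thesis
    by (auto simp: lower_family_def window_family_def)
qed

lemma upper_family_eq: "k \<le> n \<Longrightarrow> upper_family n k = window_family n k ((n - k + 1) div 2)"
proof -
  assume k: "k \<le> n"
  have "\<lceil>(real n - real k) / 2\<rceil> = int ((n - k + 1) div 2)"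
       "\<lceil>(real n + real k) / 2\<rceil> = int ((n - k + 1) div 2 + k)"
    using k by (simp_all add: ceiling_eq_iff) linarith+
  then show ?thesis
    by (auto simp: upper_family_def window_family_def)
qed

text \<open>The lower bounds are at most 0 and the upper ones at least \<open>n\<close>, so they
  exclude no set.\<close>

lemma families_eq_Pow:
  assumes "n \<le> k"
  shows "lower_family n k = Pow {1..n}" "upper_family n k = Pow {1..n}"
proof -
  have bounds: "\<lfloor>(real n - real k) / 2\<rfloor> \<le> 0" "\<lceil>(real n - real k) / 2\<rceil> \<le> 0"
      "int n \<le> \<lfloor>(real n + real k) / 2\<rfloor>" "int n \<le> \<lceil>(real n + real k) / 2\<rceil>"
    using assms by (simp_all add: floor_le_iff ceiling_le_iff le_floor_iff le_ceiling_iff)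
  have card: "0 \<le> int (card A)" "int (card A) \<le> int n" if "A \<subseteq> {1..n}" for A
    using that card_mono[of "{1..n}" A] by simp_all
  show "lower_family n k = Pow {1..n}"
    unfolding lower_family_def Pow_def
    using card order_trans[OF bounds(1)] order_trans[OF _ bounds(3)] by blast
  show "upper_family n k = Pow {1..n}"
    unfolding upper_family_def Pow_def
    using card order_trans[OF bounds(2)] order_trans[OF _ bounds(4)] by blast
qed

lemma gap_bounded_Pow:
  assumes "n \<le> k"
  shows "gap_bounded n k F \<longleftrightarrow> F \<subseteq> Pow {1..n}"
proof -
  have "card (B - A) \<le> k" if "F \<subseteq> Pow {1..n}" "B \<in> F" for A B
    using that assms card_mono[of "{1..n}" "B - A"] by fastforce
  then show ?thesis
    unfolding gap_bounded_def by (meson not_less)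
qed

text \<open>The members of a chain have distinct sizes, and only \<open>n + 1\<close> sizes are
  available.\<close>

lemma num_chains_long:
  assumes "n + 1 < l" "F \<subseteq> Pow {1..n}"
  shows "num_chains n l F = 0"
proof -
  have "profiles l {..n} = {}"
  proof (intro equals0I)
    fix xs assume "xs \<in> profiles l {..n}"
    then have xs: "sorted_wrt (<) xs" "length xs = l" "set xs \<subseteq> {..n}"
      by (auto simp: profiles_def)
    then have "card (set xs) = l"
      using strict_sorted_imp_sorted strict_sorted_iff distinct_card by blast
    then show False
      using card_mono[OF _ xs(3)] assms(1) by simp
  qed
  then show ?thesis
    by (simp add: num_chains_eq_sum[OF assms(2)])
qed

theorem theorem5p5:
  fixes n k l :: nat
  assumes "n \<ge> 1" and "l \<ge> 1" and "l \<le> k + 1"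
  shows "is_arg_max (num_chains n l) (gap_bounded n k) (lower_family n k)
    \<and> is_arg_max (num_chains n l) (gap_bounded n k) (upper_family n k)
    \<and> (l \<le> n + 1 \<longrightarrow>
          {F. is_arg_max (num_chains n l) (gap_bounded n k) F}
            = {lower_family n k, upper_family n k})
    \<and> (even (n + k) \<longrightarrow> lower_family n k = upper_family n k)"
proof (cases "k \<le> n")
  case True
  have "(n - k + 1) div 2 = (n - k) div 2" if "even (n + k)"
    using that True by simp
  then show ?thesis
    using is_arg_max_num_chains_iff[OF True assms(2,3)] lower_family_eq[OF True]
      upper_family_eq[OF True] by auto
next
  case False
  then have fam: "lower_family n k = Pow {1..n}" "upper_family n k = Pow {1..n}"
    by (auto simp: families_eq_Pow)
  show ?thesis
  proof (cases "l \<le> n + 1")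
    case True
    \<comment> \<open>For \<open>k > n\<close> the gap condition excludes nothing, just as for
      \<open>k = n\<close>, so the characterisation for \<open>k = n\<close> applies; there both
      central windows start at level 0.\<close>
    have "gap_bounded n k = gap_bounded n n"
      using False by (auto simp: gap_bounded_Pow fun_eq_iff)
    moreover have "window_family n n 0 = Pow {1..n}"
      using lower_family_eq[of n n] families_eq_Pow(1)[of n n] by simp
    ultimately have "is_arg_max (num_chains n l) (gap_bounded n k) F \<longleftrightarrow> F = Pow {1..n}" for F
      using is_arg_max_num_chains_iff[of n n l F] True assms(2) by simp
    then show ?thesis using fam by auto
  next
    case long: False
    \<comment> \<open>No chain is this long: every admissible family attains the maximum 0, and the
      clause on the set of maximisers is vacuous.\<close>
    then have "num_chains n l F = 0" if "gap_bounded n k F" for F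
      using that by (intro num_chains_long) (auto simp: gap_bounded_def)
    moreover have "gap_bounded n k (Pow {1..n})"
      using False by (simp add: gap_bounded_Pow)
    ultimately show ?thesis
      using long fam by (simp add: is_arg_max_def)
  qed
qed

end
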